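(* Let $u$ and $v$ be any two $\mathbf{c}\mathbf{d}$-monomials (words in the non-commuting letters $\mathbf{c},\mathbf{d}$, possibly the empty word $1$). Then the $\mathbf{c}\mathbf{d}$-polynomial $u\diamond v$ is given by $$u\diamond v=\sum_{P\in \Gamma(u,v)} \operatorname{wt}_{u,v}(P),$$ where $\diamond$ is the diamond product on $\mathbb{Z}\langle\mathbf{c},\mathbf{d}\rangle$, $\Gamma(u,v)$ is the set of admissible lattice paths associated with $u$ and $v$, and $\operatorname{wt}_{u,v}$ is the associated weight function.
   Context: **Ring, coproduct, derivation.** $\mathbb{Z}\langle\mathbf{c},\mathbf{d}\rangle$ is the ring of polynomials in non-commuting variables $\mathbf{c}$ (degree $1$) and $\mathbf{d}$ (degree $2$); it may be regarded as the subring of $\mathbb{Z}\langle\mathbf{a},\mathbf{b}\rangle$ generated by $\mathbf{c}=\mathbf{a}+\mathbf{b}$ and $\mathbf{d}=\mathbf{a}\mathbf{b}+\mathbf{b}\mathbf{a}$. The coproduct $\Delta:\mathbb{Z}\langle\mathbf{c},\mathbf{d}\rangle\to\mathbb{Z}\langle\mathbf{c},\mathbf{d}\rangle\otimes\mathbb{Z}\langle\mathbf{c},\mathbf{d}\rangle$, written $\Delta(u)=\sum_u u_{(1)}\otimes u_{(2)}$ in Sweedler notation, is the linear map determined by $\Delta(1)=0$, $\Delta(\mathbf{c})=2\cdot 1\otimes 1$, $\Delta(\mathbf{d})=1\otimes\mathbf{c}+\mathbf{c}\otimes 1$ and $$\Delta(u\cdot v)=\sum_u u_{(1)}\otimes u_{(2)}\cdot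 v+\sum_v u\cdot v_{(1)}\otimes v_{(2)}.$$ $G$ is the derivation on $\mathbb{Z}\langle\mathbf{c},\mathbf{d}\rangle$ (linear, $G(uv)=G(u)v+uG(v)$) with $G(\mathbf{c})=\mathbf{d}$ and $G(\mathbf{d})=\mathbf{c}\cdot\mathbf{d}$, and $\operatorname{Pyr}(u)=u\cdot\mathbf{c}+G(u)$. **Diamond product.** $\diamond:\mathbb{Z}\langle\mathbf{c},\mathbf{d}\rangle\times\mathbb{Z}\langle\mathbf{c},\mathbf{d}\rangle\to\mathbb{Z}\langle\mathbf{c},\mathbf{d}\rangle$ is the bilinear operator (determined uniquely) satisfying, for all $\mathbf{c}\mathbf{d}$-polynomials $u,v$, $$u\diamond 1=u,$$ $$u\diamond (v\cdot \mathbf{c}) =(u\diamond v)\cdot \mathbf{c} + \sum_u (u_{(1)} \diamond v)\cdot \mathbf{d} \cdot u_{(2)},$$ $$u\diamond (v\cdot \mathbf{d}) = (u\diamond v)\cdot \mathbf{d} + \sum_u (u_{(1)} \diamond v)\cdot \mathbf{d} \cdot \operatorname{Pyr}(u_{(2)}).$$ **Lattice paths.** Lattice paths are words in the letters $\mathbf{R}=(1,0)$, $\mathbf{U}=(0,1)$, $\mathbf{D}=(1,1)$, $\overline{\mathbf{R}}=(2,0)$ (double right), $\overline{\mathbf{U}}=(0,2)$ (double up), read as successive steps starting at the origin. $\Gamma(p,q)$ is the set of all such paths from $(0,0)$ to $(p,q)$ that do not contain any of $\mathbf{U}\mathbf{R}$, $\mathbf{U}\overline{\mathbf{R}}$, $\overline{\mathbf{U}}\mathbf{R}$,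 $\overline{\mathbf{U}}\,\overline{\mathbf{R}}$ as consecutive steps. **Labels.** Let $u,v$ have degrees $p,q$. Label the horizontal axis from $0$ to $p$ by the letters of $u$ in order from left to right, and the vertical axis from $0$ to $q$ by the letters of $v$ in order from bottom to top, where a $\mathbf{c}$ label covers one unit and a $\mathbf{d}$ label covers two units. The two units of a horizontal $\mathbf{d}$ label are its first part (left) and second part (right); the two units of a vertical $\mathbf{d}$ label are its bottom (half) and top (half). A step is "above" the part of the horizontal axis over which its $x$-coordinate moves, and "to the right of" the part of the vertical axis over which its $y$-coordinate moves. **The set $\Gamma(u,v)$.** It consists of the paths in $\Gamma(p,q)$ satisfying: 1. No $\mathbf{U}$ step is to the right of the bottom of a $\mathbf{d}$ label on the vertical axis. 2. An $\mathbf{R}$ step is allowed above the first part of a $\mathbf{d}$ label on the horizontal axis, but two consecutive $\mathbf{R}$ steps above the (first and second parts of the) same $\mathbf{d}$ label are not allowed. 3. A $\overline{\mathbf{U}}$ step is allowed only when it starts at the bottom of a $\mathbf{d}$ label on the vertical axis (so that it exactly spans that label), and an $\overline{\mathbf{R}}$ step is allowed only when it starts at the left end of a $\mathbf{d}$ label on the horizontal axis (so that it exactly spans that label). 4. If a $\mathbf{D}$ step of the path is to the right of the bottom of a $\mathbf{d}$ label on the vertical axis, then the path may not contain consecutive steps $\mathbf{D}\mathbf{R}$ above a single $\mathbf{d}$ label on the horizontal axis ($\mathbf{D}$ above its first part, $\mathbf{R}$ above its second part) in which this $\mathbf{D}$ is to the right of the top half of that same vertical $\mathbf{d}$ label. **The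 weight.** For $P\in\Gamma(u,v)$, $\operatorname{wt}_{u,v}(P)\in\mathbb{Z}\langle\mathbf{c},\mathbf{d}\rangle$ is the product, in order along the path, of the weights of its steps: $\mathbf{R}$ and $\mathbf{U}$ steps have weight $\mathbf{c}$; $\overline{\mathbf{R}}$ and $\overline{\mathbf{U}}$ steps have weight $\mathbf{d}$; a $\mathbf{D}$ step has weight $k\mathbf{d}$, where - $k=2$ if the $\mathbf{D}$ step is above a $\mathbf{c}$ label and to the right of either a $\mathbf{c}$ label or the bottom of a $\mathbf{d}$ label; - $k=2$ if it is above the first part of a $\mathbf{d}$ label, to the right of a $\mathbf{c}$ label, and (immediately) followed by a $\mathbf{U}$, $\overline{\mathbf{U}}$ or $\mathbf{D}$ step; - $k=2$ if it is above the first part of a $\mathbf{d}$ label, to the right of the bottom of a $\mathbf{d}$ label, and (immediately) followed by a $\mathbf{U}$ step; - $k=1$ otherwise. *)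

theory Defs
  imports Complex_Main "HOL-Library.Poly_Mapping" "HOL-Library.Product_Plus"
begin

section \<open>The ring \<open>\<int>\<langle>c,d\<rangle>\<close>\<close>

text \<open>Words form the free monoid, written additively because the ring structure of
  \<^theory>\<open>HOL-Library.Poly_Mapping\<close> is convolution over an additive monoid of exponents.
  Finitely supported integer functions on words then form the free (noncommutative) ring.\<close>

instantiation list :: (type) monoid_add
begin

definition zero_list :: "'a list" where "0 = []"

definition plus_list :: "'a list \<Rightarrow> 'a list \<Rightarrow> 'a list" where "xs + ys = xs @ ys"

instance by standard (simp_all add: zero_list_def plus_list_def)

end

datatype letter = C | D

type_synonym cdpoly = "letter list \<Rightarrow>\<^sub>0 int"

definition monomial :: "letter list \<Rightarrow> cdpoly" where
  "monomial w = Poly_Mapping.single w 1"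

abbreviation cvar :: cdpoly (\<open>\<c>\<close>) where "\<c> \<equiv> monomial [C]"

abbreviation dvar :: cdpoly (\<open>\<d>\<close>) where "\<d> \<equiv> monomial [D]"

text \<open>The tensor square of the ring is free on pairs of words; its product
  (from \<^theory>\<open>HOL-Library.Product_Plus\<close>, componentwise concatenation)
  is \<open>(x \<otimes> y) (x' \<otimes> y') = x x' \<otimes> y y'\<close>.\<close>

type_synonym cdtensor = "(letter list \<times> letter list) \<Rightarrow>\<^sub>0 int"

definition tensor :: "cdpoly \<Rightarrow> cdpoly \<Rightarrow> cdtensor" where
  "tensor f g = (\<Sum>x\<in>Poly_Mapping.keys f. \<Sum>y\<in>Poly_Mapping.keys g.
     Poly_Mapping.single (x, y) (Poly_Mapping.lookup f x * Poly_Mapping.lookup g y))"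


section \<open>Coproduct, derivation and diamond product\<close>

text \<open>Over the integers, linear maps are the same as additive maps.\<close>

definition is_coproduct :: "(cdpoly \<Rightarrow> cdtensor) \<Rightarrow> bool" where
  "is_coproduct \<Delta> \<longleftrightarrow> additive \<Delta> \<and>
     \<Delta> 1 = 0 \<and> \<Delta> \<c> = 2 * tensor 1 1 \<and> \<Delta> \<d> = tensor 1 \<c> + tensor \<c> 1 \<and>
     (\<forall>u v. \<Delta> (u * v) = \<Delta> u * tensor 1 v + tensor u 1 * \<Delta> v)"

definition coproduct :: "cdpoly \<Rightarrow> cdtensor" where
  "coproduct = (THE \<Delta>. is_coproduct \<Delta>)"

definition is_G :: "(cdpoly \<Rightarrow> cdpoly) \<Rightarrow> bool" where
  "is_G g \<longleftrightarrow> additive g \<and> g \<c> = \<d> \<and> g \<d> = \<c> * \<d> \<and>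
     (\<forall>u v. g (u * v) = g u * v + u * g v)"

definition G :: "cdpoly \<Rightarrow> cdpoly" where
  "G = (THE g. is_G g)"

definition Pyr :: "cdpoly \<Rightarrow> cdpoly" where
  "Pyr u = u * \<c> + G u"

definition lin_ext :: "('k \<Rightarrow> 'r::ring_1) \<Rightarrow> ('k \<Rightarrow>\<^sub>0 int) \<Rightarrow> 'r" where
  "lin_ext f p = (\<Sum>x\<in>Poly_Mapping.keys p. of_int (Poly_Mapping.lookup p x) * f x)"

text \<open>For biadditive \<open>B\<close>, \<open>sweedler B u\<close> is \<open>\<Sum>\<^sub>u B u\<^sub>(\<^sub>1\<^sub>) u\<^sub>(\<^sub>2\<^sub>)\<close>: the linear map on the
  tensor square induced by \<open>B\<close>, applied to the coproduct of \<open>u\<close>.\<close>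

definition sweedler :: "(cdpoly \<Rightarrow> cdpoly \<Rightarrow> cdpoly) \<Rightarrow> cdpoly \<Rightarrow> cdpoly" where
  "sweedler B u = lin_ext (\<lambda>(x, y). B (monomial x) (monomial y)) (coproduct u)"

definition is_diamond :: "(cdpoly \<Rightarrow> cdpoly \<Rightarrow> cdpoly) \<Rightarrow> bool" where
  "is_diamond f \<longleftrightarrow>
     (\<forall>v. additive (\<lambda>u. f u v)) \<and> (\<forall>u. additive (f u)) \<and>
     (\<forall>u. f u 1 = u) \<and>
     (\<forall>u v. f u (v * \<c>) = f u v * \<c> + sweedler (\<lambda>u1 u2. f u1 v * \<d> * u2) u) \<and>
     (\<forall>u v. f u (v * \<d>) = f u v * \<d> + sweedler (\<lambda>u1 u2. f u1 v * \<d> * Pyr u2) u)"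

definition diamond :: "cdpoly \<Rightarrow> cdpoly \<Rightarrow> cdpoly" (infixl \<open>\<diamondop>\<close> 70) where
  "diamond = (THE f. is_diamond f)"


section \<open>Existence and uniqueness\<close>

lemma lin_ext_superset:
  assumes "finite A" "Poly_Mapping.keys p \<subseteq> A"
  shows "lin_ext f p = (\<Sum>x\<in>A. of_int (Poly_Mapping.lookup p x) * f x)"
  unfolding lin_ext_def using assms
  by (intro sum.mono_neutral_left) (auto simp: in_keys_iff)

lemma additive_lin_ext: "additive (lin_ext f)"
proof
  fix p q :: "'a \<Rightarrow>\<^sub>0 int"
  let ?A = "Poly_Mapping.keys p \<union> Poly_Mapping.keys q"
  have *: "finite ?A" "Poly_Mapping.keys p \<subseteq> ?A" "Poly_Mapping.keys q \<subseteq> ?A" "Poly_Mapping.keys (p + q) \<subseteq> ?A"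
    by (auto dest: subsetD[OF keys_add])
  show "lin_ext f (p + q) = lin_ext f p + lin_ext f q"
    unfolding lin_ext_superset[OF *(1,2)] lin_ext_superset[OF *(1,3)] lin_ext_superset[OF *(1,4)]
    by (simp add: lookup_add algebra_simps sum.distrib)
qed

lemma lin_ext_add: "lin_ext f (p + q) = lin_ext f p + lin_ext f q"
  using additive_lin_ext by (rule additive.add)

lemma lin_ext_single: "lin_ext f (Poly_Mapping.single x 1) = f x"
  by (simp add: lin_ext_def)

lemma additive_of_int:
  fixes F :: "'a::ab_group_add \<Rightarrow> 'b::ab_group_add" and g :: "int \<Rightarrow> 'a"
  assumes "additive F" "additive g"
  shows "additive (\<lambda>k. F (g k))"
  using assms by (simp add: additive_def)

lemma additive_int_eq:
  fixes F :: "int \<Rightarrow> 'r::ring_1"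
  assumes "additive F"
  shows "F k = of_int k * F 1"
proof (induction k rule: int_induct[where k = 0])
  case base
  then show ?case using additive.zero[OF assms] by simp
next
  case (step1 i)
  then show ?case using additive.add[OF assms] by (simp add: algebra_simps)
next
  case (step2 i)
  then show ?case using additive.diff[OF assms] by (simp add: algebra_simps)
qed

lemma additive_eq_lin_ext:
  fixes F :: "('k \<Rightarrow>\<^sub>0 int) \<Rightarrow> 'r::ring_1"
  assumes F: "additive F"
  shows "F = lin_ext (\<lambda>x. F (Poly_Mapping.single x 1))"
proof
  fix p :: "'k \<Rightarrow>\<^sub>0 int"
  have s: "F (Poly_Mapping.single x k) = of_int k * F (Poly_Mapping.single x 1)" for x k
    by (rule additive_int_eq[of "\<lambda>k. F (Poly_Mapping.single x k)"], rule additive_of_int[OF F]) (simp add: additive_def single_add)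
  have p: "p = (\<Sum>x\<in>Poly_Mapping.keys p. Poly_Mapping.single x (Poly_Mapping.lookup p x))"
    by (rule poly_mapping_eqI)
      (auto simp: lookup_sum lookup_single when_def in_keys_iff)
  show "F p = lin_ext (\<lambda>x. F (Poly_Mapping.single x 1)) p"
    unfolding lin_ext_def s[symmetric] additive.sum[OF F, symmetric] by (simp flip: p)
qed

lemma additive_eqI:
  fixes F H :: "('k \<Rightarrow>\<^sub>0 int) \<Rightarrow> 'r::ring_1"
  assumes "additive F" "additive H"
    and "\<And>x. F (Poly_Mapping.single x 1) = H (Poly_Mapping.single x 1)"
  shows "F = H"
proof -
  have "F = lin_ext (\<lambda>x. F (Poly_Mapping.single x 1))"
    by (rule additive_eq_lin_ext) fact
  also have "\<dots> = lin_ext (\<lambda>x. H (Poly_Mapping.single x 1))"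
    by (simp only: assms(3))
  also have "\<dots> = H"
    by (rule additive_eq_lin_ext[symmetric]) fact
  finally show ?thesis .
qed

lemma biadditive_eqI:
  fixes F H :: "('k \<Rightarrow>\<^sub>0 int) \<Rightarrow> ('l \<Rightarrow>\<^sub>0 int) \<Rightarrow> 'r::ring_1"
  assumes "\<And>p. additive (F p)" "\<And>p. additive (H p)"
    and "\<And>q. additive (\<lambda>p. F p q)" "\<And>q. additive (\<lambda>p. H p q)"
    and "\<And>x y. F (Poly_Mapping.single x 1) (Poly_Mapping.single y 1)
             = H (Poly_Mapping.single x 1) (Poly_Mapping.single y 1)"
  shows "F p q = H p q"
proof -
  have "F (Poly_Mapping.single x 1) = H (Poly_Mapping.single x 1)" for x
    using assms by (intro additive_eqI) auto
  then have "(\<lambda>p. F p q) = (\<lambda>p. H p q)"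
    using assms by (intro additive_eqI) auto
  then show ?thesis by meson
qed

lemma monomial_Nil: "monomial [] = 1"
  by (simp add: monomial_def flip: zero_list_def)

lemma monomial_mult: "monomial x * monomial y = monomial (x @ y)"
  by (simp add: monomial_def mult_single plus_list_def)

lemma monomial_Cons: "monomial (l # w) = monomial [l] * monomial w"
  by (simp add: monomial_mult)

lemma ex1_twisted_derivation:
  fixes \<phi> \<psi> :: "cdpoly \<Rightarrow> 'r::ring_1"
  assumes \<phi>: "additive \<phi>" "\<phi> 1 = 1" "\<And>x y. \<phi> (x * y) = \<phi> x * \<phi> y"
    and \<psi>: "additive \<psi>" "\<psi> 1 = 1" "\<And>x y. \<psi> (x * y) = \<psi> x * \<psi> y"
  shows "\<exists>!\<delta>. additive \<delta> \<and> \<delta> \<c> = a \<and> \<delta> \<d> = b \<and>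
    (\<forall>u v. \<delta> (u * v) = \<delta> u * \<psi> v + \<phi> u * \<delta> v)"
proof (rule ex_ex1I)
  define e where "e l = (case l of C \<Rightarrow> a | D \<Rightarrow> b)" for l
  define W where "W = rec_list 0 (\<lambda>l w r. e l * \<psi> (monomial w) + \<phi> (monomial [l]) * r)"
  have W: "W [] = 0" "\<And>l w. W (l # w) = e l * \<psi> (monomial w) + \<phi> (monomial [l]) * W w"
    by (simp_all add: W_def)
  have W_app: "W (x @ y) = W x * \<psi> (monomial y) + \<phi> (monomial x) * W y" for x y
  proof (induction x)
    case Nil
    then show ?case by (simp add: W monomial_Nil \<phi>)
  next
    case (Cons l x)
    show ?case
      unfolding append_Cons W Cons.IH monomial_Cons[of l x]
      by (simp add: \<phi> \<psi> algebra_simps flip: monomial_mult)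
  qed
  define \<delta> where "\<delta> = lin_ext W"
  have add: "additive \<delta>" unfolding \<delta>_def by (rule additive_lin_ext)
  have \<delta>_mono: "\<delta> (monomial w) = W w" for w
    by (simp add: \<delta>_def monomial_def lin_ext_single)
  note ads = additive.add[OF add] additive.add[OF \<phi>(1)] additive.add[OF \<psi>(1)]
  have "\<delta> (u * v) = \<delta> u * \<psi> v + \<phi> u * \<delta> v" for u v
    by (rule biadditive_eqI[of "\<lambda>u v. \<delta> (u * v)" "\<lambda>u v. \<delta> u * \<psi> v + \<phi> u * \<delta> v"])
      (simp_all add: additive_def ads algebra_simps \<delta>_mono W_app monomial_mult flip: monomial_def)
  moreover have "\<delta> \<c> = a" "\<delta> \<d> = b"
    by (simp_all add: \<delta>_mono W e_def monomial_Nil \<psi>)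
  ultimately show "\<exists>\<delta>. additive \<delta> \<and> \<delta> \<c> = a \<and> \<delta> \<d> = b \<and>
    (\<forall>u v. \<delta> (u * v) = \<delta> u * \<psi> v + \<phi> u * \<delta> v)"
    using add by blast
next
  fix F H
  assume F: "additive F \<and> F \<c> = a \<and> F \<d> = b \<and> (\<forall>u v. F (u * v) = F u * \<psi> v + \<phi> u * F v)"
    and H: "additive H \<and> H \<c> = a \<and> H \<d> = b \<and> (\<forall>u v. H (u * v) = H u * \<psi> v + \<phi> u * H v)"
  have one: "F 1 = 0" "H 1 = 0"
    using F[THEN conjunct2, THEN conjunct2, THEN conjunct2, rule_format, of 1 1]
      H[THEN conjunct2, THEN conjunct2, THEN conjunct2, rule_format, of 1 1] \<phi> \<psi> by simp_all
  have "F (monomial w) = H (monomial w)" for w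
  proof (induction w)
    case Nil
    then show ?case by (simp add: monomial_Nil one)
  next
    case (Cons l w)
    have "F (monomial [l]) = H (monomial [l])" using F H by (cases l) auto
    then show ?case
      unfolding monomial_Cons[of l w] using F H Cons.IH by simp
  qed
  then show "F = H" using F H by (intro additive_eqI) (auto simp: monomial_def)
qed

lemma tensor_lin_ext: "tensor f g = lin_ext (\<lambda>x. lin_ext (\<lambda>y. Poly_Mapping.single (x, y) 1) g) f"
proof -
  have c: "of_int k * Poly_Mapping.single z m = Poly_Mapping.single z (k * m)"
    for k m and z :: "letter list \<times> letter list"
    by (simp only: single_of_int[symmetric] mult_single add_0 of_int_eq_id id_apply)
  show ?thesis
    by (simp add: tensor_def lin_ext_def sum_distrib_left c)
qed

lemma tensor_add_left: "tensor (f + f') g = tensor f g + tensor f' g"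
  by (simp add: tensor_lin_ext lin_ext_add)

lemma tensor_add_right: "tensor f (g + g') = tensor f g + tensor f g'"
  by (simp add: tensor_lin_ext lin_ext_add) (simp add: lin_ext_def algebra_simps sum.distrib)

lemma tensor_monomial: "tensor (monomial x) (monomial y) = Poly_Mapping.single (x, y) 1"
  by (simp add: tensor_def monomial_def)

lemma tensor_1_1: "tensor 1 1 = 1"
proof -
  have "tensor 1 1 = Poly_Mapping.single ([], []) 1"
    using tensor_monomial[of "[]" "[]"] by (simp only: monomial_Nil)
  then show ?thesis
    by (simp only: zero_list_def[symmetric] zero_prod_def[symmetric] single_one)
qed

lemma tensor_1_mult: "tensor 1 (u * v) = tensor 1 u * tensor 1 v"
  by (rule biadditive_eqI[of "\<lambda>u v. tensor 1 (u * v)" "\<lambda>u v. tensor 1 u * tensor 1 v"])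
    (simp_all add: additive_def tensor_add_right algebra_simps monomial_mult tensor_monomial mult_single
      plus_prod_def plus_list_def flip: monomial_def monomial_Nil)

lemma tensor_mult_1: "tensor (u * v) 1 = tensor u 1 * tensor v 1"
  by (rule biadditive_eqI[of "\<lambda>u v. tensor (u * v) 1" "\<lambda>u v. tensor u 1 * tensor v 1"])
    (simp_all add: additive_def tensor_add_left algebra_simps monomial_mult tensor_monomial mult_single
      plus_prod_def plus_list_def flip: monomial_def monomial_Nil)

lemma ex1_coproduct: "\<exists>!\<Delta>. is_coproduct \<Delta>"
proof -
  have *: "is_coproduct = (\<lambda>\<delta>. additive \<delta> \<and> \<delta> \<c> = 2 * tensor 1 1 \<and>
      \<delta> \<d> = tensor 1 \<c> + tensor \<c> 1 \<and>
      (\<forall>u v. \<delta> (u * v) = \<delta> u * tensor 1 v + tensor u 1 * \<delta> v))"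
  proof (rule ext)
    fix \<delta> :: "cdpoly \<Rightarrow> cdtensor"
    have "\<delta> 1 = 0" if "\<forall>u v. \<delta> (u * v) = \<delta> u * tensor 1 v + tensor u 1 * \<delta> v"
      using that[rule_format, of 1 1] by (simp add: tensor_1_1)
    then show "is_coproduct \<delta> = (additive \<delta> \<and> \<delta> \<c> = 2 * tensor 1 1 \<and>
      \<delta> \<d> = tensor 1 \<c> + tensor \<c> 1 \<and>
      (\<forall>u v. \<delta> (u * v) = \<delta> u * tensor 1 v + tensor u 1 * \<delta> v))"
      unfolding is_coproduct_def by blast
  qed
  show ?thesis unfolding *
    by (rule ex1_twisted_derivation[where \<phi> = "\<lambda>u. tensor u 1" and \<psi> = "tensor 1"])
      (simp_all add: additive_def tensor_add_left tensor_add_right tensor_1_1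
        tensor_1_mult tensor_mult_1)
qed

lemma is_coproduct_coproduct: "is_coproduct coproduct"
  unfolding coproduct_def using ex1_coproduct by (rule theI')

lemma ex1_G: "\<exists>!g. is_G g"
  unfolding is_G_def
  by (rule ex1_twisted_derivation[where \<phi> = "\<lambda>u. u" and \<psi> = "\<lambda>u. u"])
    (simp_all add: additive_def)

lemma is_G_G: "is_G G"
  unfolding G_def using ex1_G by (rule theI')

lemma Pyr_add: "Pyr (u + v) = Pyr u + Pyr v"
  using is_G_G by (simp add: Pyr_def is_G_def additive_def algebra_simps)

lemma sweedler_add: "sweedler B (u + v) = sweedler B u + sweedler B v"
  using is_coproduct_coproduct
  by (simp add: sweedler_def is_coproduct_def additive_def lin_ext_add)

lemma sweedler_fun_add:
  "sweedler (\<lambda>x y. A x y + B x y) u = sweedler A u + sweedler B u"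
  by (simp add: sweedler_def lin_ext_def sum.distrib algebra_simps case_prod_unfold)

lemma ex1_diamond: "\<exists>!f. is_diamond f"
proof (rule ex_ex1I)
  define L where "L l = (case l of C \<Rightarrow> (\<lambda>y. y) | D \<Rightarrow> Pyr)" for l
  define W where "W = rec_list (\<lambda>u. u)
    (\<lambda>l w r u. r u * monomial [l] + sweedler (\<lambda>x y. r x * \<d> * L l y) u)"
  have W: "W [] = (\<lambda>u. u)"
    "\<And>l w. W (l # w) = (\<lambda>u. W w u * monomial [l] + sweedler (\<lambda>x y. W w x * \<d> * L l y) u)"
    by (simp_all add: W_def)
  have W_add: "W w (u + v) = W w u + W w v" for w u v
    by (induction w) (simp_all add: W sweedler_add algebra_simps)
  define f where "f u v = lin_ext (\<lambda>w. W (rev w) u) v" for u v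
  have f1: "f (u + u') v = f u v + f u' v" for u u' v
    by (simp add: f_def lin_ext_def W_add algebra_simps sum.distrib)
  have f2: "f u (v + v') = f u v + f u v'" for u v v'
    by (simp add: f_def lin_ext_add)
  have f_mono: "f u (monomial w) = W (rev w) u" for u w
    by (simp add: f_def monomial_def lin_ext_single)
  have step: "f u (v * monomial [l]) = f u v * monomial [l] + sweedler (\<lambda>x y. f x v * \<d> * L l y) u"
    for u v l
  proof -
    have "(\<lambda>v. f u (v * monomial [l])) =
      (\<lambda>v. f u v * monomial [l] + sweedler (\<lambda>x y. f x v * \<d> * L l y) u)"
    proof (rule additive_eqI)
      show "additive (\<lambda>v. f u (v * monomial [l]))"
        by (simp add: additive_def f2 algebra_simps)
      show "additive (\<lambda>v. f u v * monomial [l] + sweedler (\<lambda>x y. f x v * \<d> * L l y) u)"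
        by (simp add: additive_def f2 distrib_right sweedler_fun_add)
      show "f u (Poly_Mapping.single x 1 * monomial [l]) =
        f u (Poly_Mapping.single x 1) * monomial [l] +
        sweedler (\<lambda>xa y. f xa (Poly_Mapping.single x 1) * \<d> * L l y) u" for x
        by (simp add: monomial_mult f_mono W flip: monomial_def)
    qed
    then show ?thesis by meson
  qed
  have "is_diamond f"
    unfolding is_diamond_def
    using step[of _ _ C] step[of _ _ D] f_mono[of _ "[]"]
    by (simp add: additive_def f1 f2 L_def monomial_Nil W)
  then show "\<exists>f. is_diamond f" by blast
next
  fix f g
  assume f: "is_diamond f" and g: "is_diamond g"
  have "f u (monomial w) = g u (monomial w)" for u w
  proof (induction w arbitrary: u rule: rev_induct)
    case Nil
    then show ?case using f g by (simp add: is_diamond_def monomial_Nil)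
  next
    case (snoc l w)
    show ?case
    proof (cases l)
      case C
      then show ?thesis
        unfolding monomial_mult[symmetric] using f g snoc.IH by (simp add: is_diamond_def)
    next
      case D
      then show ?thesis
        unfolding monomial_mult[symmetric] using f g snoc.IH by (simp add: is_diamond_def)
    qed
  qed
  then have "f u = g u" for u
    using f g by (intro additive_eqI) (auto simp: is_diamond_def monomial_def)
  then show "f = g" ..
qed

lemma is_diamond_diamond: "is_diamond diamond"
  unfolding diamond_def using ex1_diamond by (rule theI')


section \<open>Lattice paths\<close>

text \<open>\<open>RR\<close> and \<open>UU\<close> are the double steps.\<close>

datatype step = R | U | Diag | RR | UU

fun dx :: "step \<Rightarrow> nat" where
  "dx R = 1" | "dx U = 0" | "dx Diag = 1" | "dx RR = 2" | "dx UU = 0"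

fun dy :: "step \<Rightarrow> nat" where
  "dy R = 0" | "dy U = 1" | "dy Diag = 1" | "dy RR = 0" | "dy UU = 2"

text \<open>The starting point of the \<open>i\<close>-th step (counted from 0) is \<open>(xpos P i, ypos P i)\<close>.\<close>

definition xpos :: "step list \<Rightarrow> nat \<Rightarrow> nat" where
  "xpos P i = sum_list (map dx (take i P))"

definition ypos :: "step list \<Rightarrow> nat \<Rightarrow> nat" where
  "ypos P i = sum_list (map dy (take i P))"

definition paths :: "nat \<Rightarrow> nat \<Rightarrow> step list set" where
  "paths p q = {P. xpos P (length P) = p \<and> ypos P (length P) = q \<and>
     (\<forall>i. Suc i < length P \<longrightarrow> \<not> (P ! i \<in> {U, UU} \<and> P ! Suc i \<in> {R, RR}))}"

text \<open>\<open>axis w ! i\<close> is the part of a label covering the unit interval \<open>[i, i + 1]\<close> of an axis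
  labelled by \<open>w\<close>. For a vertical axis, \<open>D1\<close> and \<open>D2\<close> are the bottom and top half.\<close>

datatype label_part = C1 | D1 | D2

definition axis :: "letter list \<Rightarrow> label_part list" where
  "axis w = concat (map (\<lambda>l. case l of C \<Rightarrow> [C1] | D \<Rightarrow> [D1, D2]) w)"

definition deg :: "letter list \<Rightarrow> nat" where
  "deg w = (\<Sum>l\<leftarrow>w. case l of C \<Rightarrow> 1 | D \<Rightarrow> 2)"

definition above_part :: "letter list \<Rightarrow> step list \<Rightarrow> nat \<Rightarrow> label_part" where
  "above_part u P i = axis u ! xpos P i"

definition right_part :: "letter list \<Rightarrow> step list \<Rightarrow> nat \<Rightarrow> label_part" where
  "right_part v P i = axis v ! ypos P i"

text \<open>The four conjuncts after membership in \<open>paths\<close> are the admissibility conditions, in order.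
  If a step above the first part of a \<open>d\<close> label moves one unit to the right, the next step starts
  at the second part of the same label. If step \<open>i\<close> is to the right of the bottom of a \<open>d\<close> label,
  the top half of that label is the unit interval starting at \<open>ypos P i + 1\<close>.\<close>

definition Gamma :: "letter list \<Rightarrow> letter list \<Rightarrow> step list set" where
  "Gamma u v = {P \<in> paths (deg u) (deg v).
     (\<forall>i<length P. P ! i = U \<longrightarrow> right_part v P i \<noteq> D1) \<and>
     (\<forall>i. Suc i < length P \<longrightarrow> \<not> (P ! i = R \<and> P ! Suc i = R \<and> above_part u P i = D1)) \<and>
     (\<forall>i<length P. (P ! i = UU \<longrightarrow> right_part v P i = D1) \<and>
                   (P ! i = RR \<longrightarrow> above_part u P i = D1)) \<and>
     (\<forall>i<length P. P ! i = Diag \<and> right_part v P i = D1 \<longrightarrow>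
        \<not> (\<exists>j. Suc j < length P \<and> P ! j = Diag \<and> P ! Suc j = R \<and> above_part u P j = D1 \<and>
               ypos P j = ypos P i + 1))}"

definition followed_by :: "step list \<Rightarrow> nat \<Rightarrow> step set \<Rightarrow> bool" where
  "followed_by P i S \<longleftrightarrow> Suc i < length P \<and> P ! Suc i \<in> S"

definition diag_coeff :: "letter list \<Rightarrow> letter list \<Rightarrow> step list \<Rightarrow> nat \<Rightarrow> int" where
  "diag_coeff u v P i =
     (if above_part u P i = C1 \<and> right_part v P i \<in> {C1, D1} \<or>
         above_part u P i = D1 \<and> right_part v P i = C1 \<and> followed_by P i {U, UU, Diag} \<or>
         above_part u P i = D1 \<and> right_part v P i = D1 \<and> followed_by P i {U}
      then 2 else 1)"

definition step_wt :: "letter list \<Rightarrow> letter list \<Rightarrow> step list \<Rightarrow> nat \<Rightarrow> cdpoly" where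
  "step_wt u v P i = (case P ! i of
     R \<Rightarrow> \<c> | U \<Rightarrow> \<c> | RR \<Rightarrow> \<d> | UU \<Rightarrow> \<d> | Diag \<Rightarrow> of_int (diag_coeff u v P i) * \<d>)"

definition wt :: "letter list \<Rightarrow> letter list \<Rightarrow> step list \<Rightarrow> cdpoly" where
  "wt u v P = prod_list (map (step_wt u v P) [0..<length P])"

lemma finite_Gamma: "finite (Gamma u v)"
proof (rule finite_subset)
  have len: "length P \<le> sum_list (map dx P) + sum_list (map dy P)" for P
  proof (induction P)
    case (Cons s P)
    then show ?case by (cases s) auto
  qed simp
  have "set P \<subseteq> {R, U, Diag, RR, UU}" for P
    using step.exhaust by blast
  moreover have "length P \<le> deg u + deg v" if "P \<in> Gamma u v" for P
    using that len[of P] by (simp add: Gamma_def paths_def xpos_def ypos_def)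
  ultimately show "Gamma u v \<subseteq> {P. set P \<subseteq> {R, U, Diag, RR, UU} \<and> length P \<le> deg u + deg v}"
    by blast
  show "finite {P. set P \<subseteq> {R, U, Diag, RR, UU} \<and> length P \<le> deg u + deg v}"
    by (rule finite_lists_length_le) simp
qed

end

theory Submission
  imports Defs
begin

text \<open>The path sum satisfies the defining recursion of the diamond product: for \<open>v = v' l\<close>, cut a path
  where it leaves the rows of \<open>v'\<close>. If it does so by a vertical step, that step is the last one and
  yields the term \<open>(u \<diamondop> v') l\<close>. If it does so by a diagonal step, the part before it runs over a
  prefix of \<open>u\<close>, possibly ending in the middle of a \<open>d\<close> label, which then behaves like a \<open>c\<close>;
  together with the possible ways to continue to the right this gives the Sweedler sum.

  Condition 4 looks non-local, but the middle height of a vertical \<open>d\<close> label can only be reached by a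
  diagonal step. It therefore just forbids a diagonal step above the first part of a \<open>d\<close> label and
  to the right of the top half of a \<open>d\<close> label to be followed by \<open>R\<close>. All conditions and weights thus
  depend on a step, its position and its successor only, and the path sum is computed by a recursion
  that removes the last step.\<close>

section \<open>Path sums computed by removing the last step\<close>

text \<open>Weight of a diagonal step with parts \<open>a\<close> and \<open>b\<close> followed by \<open>N\<close> (\<open>None\<close> at the end of a path),
  with condition 4 built in as weight zero.\<close>

definition diag_wt :: "label_part \<Rightarrow> label_part \<Rightarrow> step option \<Rightarrow> cdpoly" where
  "diag_wt a b N =
     (if a = D1 \<and> b = D2 \<and> N = Some R then 0
      else of_int (if a = C1 \<and> b \<in> {C1, D1} \<or>
           a = D1 \<and> b = C1 \<and> N \<in> {Some U, Some UU, Some Diag} \<or>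
           a = D1 \<and> b = D1 \<and> N = Some U then 2 else 1) * \<d>)"

text \<open>The weight of all admissible paths to the end of two axes, given in reverse order (last part
  first) so that the recursion removes the last step. The paths are to be continued by the step
  \<open>N\<close>.\<close>

function path_sum :: "label_part list \<Rightarrow> label_part list \<Rightarrow> step option \<Rightarrow> cdpoly" where
  "path_sum xs ys N =
     (if xs = [] \<and> ys = [] then 1 else 0)
   + (case xs of [] \<Rightarrow> 0 | a # xs' \<Rightarrow>
        if a = D1 \<and> N = Some R then 0 else path_sum xs' ys (Some R) * \<c>)
   + (case xs of a # b # xs' \<Rightarrow> if b = D1 then path_sum xs' ys (Some RR) * \<d> else 0 | _ \<Rightarrow> 0)
   + (if N \<in> {Some R, Some RR} then 0 else
        (case ys of [] \<Rightarrow> 0 | b # ys' \<Rightarrow> if b = D1 then 0 else path_sum xs ys' (Some U) * \<c>)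
      + (case ys of a # b # ys' \<Rightarrow> if b = D1 then path_sum xs ys' (Some UU) * \<d> else 0 | _ \<Rightarrow> 0))
   + (case (xs, ys) of (a # xs', b # ys') \<Rightarrow> path_sum xs' ys' (Some Diag) * diag_wt a b N | _ \<Rightarrow> 0)"
  by pat_completeness auto
termination
  by (relation "measure (\<lambda>(xs, ys, _). length xs + length ys)") auto

declare path_sum.simps [simp del]

definition rax :: "letter list \<Rightarrow> label_part list" where
  "rax w = rev (axis w)"

lemma rax_simps [simp]:
  "rax [] = []" "rax (w @ [C]) = C1 # rax w" "rax (w @ [D]) = D2 # D1 # rax w"
  by (simp_all add: rax_def axis_def)

lemma rax_not_D1 [simp]: "rax w \<noteq> D1 # xs"
proof (cases w rule: rev_cases)
  case (snoc w' l)
  then show ?thesis by (cases l) simp_all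
qed simp

lemma rax_cases:
  obtains "rax u = []" | u' where "rax u = C1 # rax u'" | u' where "rax u = D2 # D1 # rax u'"
proof (cases u rule: rev_cases)
  case (snoc u' l)
  then show ?thesis using that by (cases l) auto
qed (use that in auto)

lemma rax_case_D1 [simp]:
  "(case rax w of [] \<Rightarrow> 0 | a # xs \<Rightarrow> if a = D1 then f xs else 0) = (0 :: 'a :: zero)"
  by (cases w rule: rax_cases) simp_all

lemma diag_wt_simps [simp]:
  "diag_wt C1 b N = (if b = D2 then \<d> else 2 * \<d>)"
  "diag_wt D2 b N = \<d>"
  "diag_wt D1 D2 N = (if N = Some R then 0 else \<d>)"
  "diag_wt D1 C1 N = (if N \<in> {Some U, Some UU, Some Diag} then 2 * \<d> else \<d>)"
  "diag_wt D1 D1 N = (if N = Some U then 2 * \<d> else \<d>)"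
  by (cases b; simp add: diag_wt_def)+

text \<open>The last part of a complete horizontal labelling is not \<open>D1\<close>, so
  \<open>N\<close> matters only through the ban on a vertical step before a horizontal one.\<close>

lemma path_sum_next:
  assumes "N \<notin> {Some R, Some RR}"
  shows "path_sum (rax u) ys N = path_sum (rax u) ys None"
  using assms
  by (subst (1 2) path_sum.simps) (cases u rule: rax_cases; simp split: list.split)

lemma path_sum_next_RR: "path_sum (rax u) ys (Some RR) = path_sum (rax u) ys (Some R)"
  by (subst (1 2) path_sum.simps) (cases u rule: rax_cases; simp split: list.split)

text \<open>Half of a horizontal \<open>d\<close> label counts as a \<open>c\<close> label if the next step is not horizontal.\<close>

lemma path_sum_mid:
  assumes "N \<in> {Some U, Some UU, Some Diag}"
  shows "path_sum (D1 # xs) (rax v) N = path_sum (C1 # xs) (rax v) N"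
  using assms
proof (induction v arbitrary: N rule: rev_induct)
  case Nil
  then show ?case by (subst (1 2) path_sum.simps) auto
next
  case (snoc l v)
  \<comment> \<open>No vertical step ends halfway up a \<open>d\<close> label, and a diagonal step
    followed by \<open>U\<close> has coefficient 2 in both sums.\<close>
  have mid: "path_sum (D1 # xs) (D1 # rax v) (Some U) = path_sum (C1 # xs) (D1 # rax v) (Some U)"
    by (subst (1 2) path_sum.simps) simp
  have IH: "path_sum (D1 # xs) (rax v) (Some U) = path_sum (C1 # xs) (rax v) (Some U)"
    "path_sum (D1 # xs) (rax v) (Some UU) = path_sum (C1 # xs) (rax v) (Some UU)"
    using snoc.IH by simp_all
  have N: "N \<notin> {Some R, Some RR}" "N \<noteq> Some R"
    using snoc.prems by auto
  show ?case
    using snoc.prems N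
    by (cases l; subst (1 2) path_sum.simps; simp add: IH mid)
qed

lemma path_sum_mid_Diag:
  "path_sum (D1 # rax u) (rax v) (Some Diag) = path_sum (rax (u @ [C])) (rax v) None"
  using path_sum_mid[of "Some Diag" "rax u" v] path_sum_next[of "Some Diag" "u @ [C]" "rax v"]
  by simp

lemma path_sum_next_Diag: "path_sum (rax u) ys (Some Diag) = path_sum (rax u) ys None"
  by (rule path_sum_next) simp

section \<open>Recursions in the rows of the last letter\<close>

text \<open>In the rows of the last letter of \<open>v\<close>, the paths that can still be followed by \<open>R\<close> are those whose
  last step is not vertical; their sum becomes the Sweedler sum (for the upper row of a \<open>d\<close>, its
  part coming from the derivation \<open>G\<close>).\<close>

lemma path_sum_row_C:
  "path_sum (rax u) (C1 # rax v) None =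
     path_sum (rax u) (rax v) None * \<c> + path_sum (rax u) (C1 # rax v) (Some R)"
  unfolding path_sum.simps[of "rax u" "C1 # rax v" None] path_sum.simps[of "rax u" "C1 # rax v" "Some R"]
  by (simp add: path_sum_next[of "Some U"], cases u rule: rax_cases; simp)

text \<open>The ways to cross the last horizontal label mirror the Leibniz rule. A horizontal step
  spanning it extends the second tensor factor. Otherwise a \<open>c\<close> label gives 2 (1
  \<otimes> 1); for a \<open>d\<close> label, \<open>Diag\<close> then \<open>R\<close> gives 1
  \<otimes> c, and a diagonal step above the second part gives c \<otimes> 1.\<close>

lemma path_sum_row_C_rec:
  "path_sum [] (C1 # rax v) (Some R) = 0"
  "path_sum (C1 # rax u) (C1 # rax v) (Some R) =
     path_sum (rax u) (C1 # rax v) (Some R) * \<c> + 2 * path_sum (rax u) (rax v) None * \<d>"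
  "path_sum (D2 # D1 # rax u) (C1 # rax v) (Some R) =
     path_sum (rax u) (C1 # rax v) (Some R) * \<d> + path_sum (rax u) (rax v) None * \<d> * \<c>
   + path_sum (rax (u @ [C])) (rax v) None * \<d>"
proof -
  show "path_sum [] (C1 # rax v) (Some R) = 0"
    by (subst path_sum.simps) simp
  show "path_sum (C1 # rax u) (C1 # rax v) (Some R) =
     path_sum (rax u) (C1 # rax v) (Some R) * \<c> + 2 * path_sum (rax u) (rax v) None * \<d>"
    by (subst path_sum.simps) (simp add: path_sum_next_Diag mult_2 algebra_simps)
  have "path_sum (D1 # rax u) (C1 # rax v) (Some R) = path_sum (rax u) (rax v) None * \<d>"
    by (subst path_sum.simps) (simp add: path_sum_next_Diag)
  then show "path_sum (D2 # D1 # rax u) (C1 # rax v) (Some R) =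
     path_sum (rax u) (C1 # rax v) (Some R) * \<d> + path_sum (rax u) (rax v) None * \<d> * \<c>
   + path_sum (rax (u @ [C])) (rax v) None * \<d>"
    by (subst path_sum.simps)
      (simp add: path_sum_mid_Diag path_sum_next_RR algebra_simps del: rax_simps)
qed

text \<open>No vertical step ends halfway up a \<open>d\<close> label, so a horizontal
  \<open>N\<close> excludes nothing.\<close>

lemma path_sum_row_D1_next: "path_sum (rax u) (D1 # rax v) N = path_sum (rax u) (D1 # rax v) (Some R)"
  unfolding path_sum.simps[of "rax u" "D1 # rax v" N] path_sum.simps[of "rax u" "D1 # rax v" "Some R"]
  by (cases u rule: rax_cases; simp)

lemma path_sum_row_D1_mid:
  "N \<noteq> Some R \<Longrightarrow> N \<noteq> Some U \<Longrightarrow> path_sum (D1 # rax u) (D1 # rax v) N =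
     path_sum (rax u) (D1 # rax v) (Some R) * \<c> + path_sum (rax u) (rax v) None * \<d>"
  "path_sum (D1 # rax u) (D1 # rax v) (Some R) = path_sum (rax u) (rax v) None * \<d>"
  by (subst path_sum.simps; simp add: path_sum_next_Diag)+

text \<open>Before \<open>R\<close>, every crossing of the last horizontal label weighs the same
  beside a bottom half as beside a \<open>c\<close> label.\<close>

lemma path_sum_row_D1_rec:
  "path_sum [] (D1 # rax v) (Some R) = 0"
  "path_sum (C1 # rax u) (D1 # rax v) (Some R) =
     path_sum (rax u) (D1 # rax v) (Some R) * \<c> + 2 * path_sum (rax u) (rax v) None * \<d>"
  "path_sum (D2 # D1 # rax u) (D1 # rax v) (Some R) =
     path_sum (rax u) (D1 # rax v) (Some R) * \<d> + path_sum (rax u) (rax v) None * \<d> * \<c>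
   + path_sum (rax (u @ [C])) (rax v) None * \<d>"
proof -
  show "path_sum [] (D1 # rax v) (Some R) = 0"
    by (subst path_sum.simps) simp
  show "path_sum (C1 # rax u) (D1 # rax v) (Some R) =
     path_sum (rax u) (D1 # rax v) (Some R) * \<c> + 2 * path_sum (rax u) (rax v) None * \<d>"
    by (subst path_sum.simps) (simp add: path_sum_next_Diag mult_2 algebra_simps)
  show "path_sum (D2 # D1 # rax u) (D1 # rax v) (Some R) =
     path_sum (rax u) (D1 # rax v) (Some R) * \<d> + path_sum (rax u) (rax v) None * \<d> * \<c>
   + path_sum (rax (u @ [C])) (rax v) None * \<d>"
    by (subst path_sum.simps)
      (simp add: path_sum_row_D1_mid path_sum_mid_Diag path_sum_next_RR algebra_simps del: rax_simps)
qed

text \<open>The last step is \<open>UU\<close>, \<open>U\<close> or neither: this gives (u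
  \<diamondop> v) d and the parts u2 c and G(u2) of \<open>Pyr\<close>.\<close>

lemma path_sum_row_D2:
  "path_sum (rax u) (D2 # D1 # rax v) None =
     path_sum (rax u) (rax v) None * \<d> + path_sum (rax u) (D1 # rax v) (Some R) * \<c>
   + path_sum (rax u) (D2 # D1 # rax v) (Some R)"
  unfolding path_sum.simps[of "rax u" "D2 # D1 # rax v" None]
    path_sum.simps[of "rax u" "D2 # D1 # rax v" "Some R"]
  by (simp add: path_sum_next[of "Some UU"] path_sum_row_D1_next[of _ _ "Some U"],
      cases u rule: rax_cases; simp add: algebra_simps)

text \<open>A diagonal step leaving half height supplies G(c) = d, or G(d) = c d if preceded by
  \<open>R\<close> above the same label. The term \<open>\<d> * \<d>\<close>, two diagonal steps
  above one label, is G applied to the c of 1 \<otimes> c.\<close>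

lemma path_sum_row_D2_rec:
  "path_sum [] (D2 # D1 # rax v) (Some R) = 0"
  "path_sum (C1 # rax u) (D2 # D1 # rax v) (Some R) =
     path_sum (rax u) (D2 # D1 # rax v) (Some R) * \<c> + path_sum (rax u) (D1 # rax v) (Some R) * \<d>"
  "path_sum (D2 # D1 # rax u) (D2 # D1 # rax v) (Some R) =
     path_sum (rax u) (D2 # D1 # rax v) (Some R) * \<d> + path_sum (rax u) (D1 # rax v) (Some R) * \<c> * \<d>
   + path_sum (rax u) (rax v) None * \<d> * \<d>"
proof -
  show "path_sum [] (D2 # D1 # rax v) (Some R) = 0"
    by (subst path_sum.simps) simp
  show "path_sum (C1 # rax u) (D2 # D1 # rax v) (Some R) =
     path_sum (rax u) (D2 # D1 # rax v) (Some R) * \<c> + path_sum (rax u) (D1 # rax v) (Some R) * \<d>"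
    by (subst path_sum.simps) (simp add: path_sum_row_D1_next[of _ _ "Some Diag"])
  \<comment> \<open>Condition 4 acts here: the diagonal step has weight zero, and two steps
    \<open>R\<close> above one \<open>d\<close> label are excluded.\<close>
  have "path_sum (D1 # rax u) (D2 # D1 # rax v) (Some R) = 0"
    by (subst path_sum.simps) simp
  then show "path_sum (D2 # D1 # rax u) (D2 # D1 # rax v) (Some R) =
     path_sum (rax u) (D2 # D1 # rax v) (Some R) * \<d> + path_sum (rax u) (D1 # rax v) (Some R) * \<c> * \<d>
   + path_sum (rax u) (rax v) None * \<d> * \<d>"
    by (subst path_sum.simps)
      (simp add: path_sum_row_D1_mid path_sum_next_RR algebra_simps)
qed

section \<open>Sweedler sums letter by letter\<close>

lemma lin_ext_mult_single:
  fixes f :: "'k::monoid_add \<Rightarrow> 'r::ring_1"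
  shows "lin_ext f (t * Poly_Mapping.single z 1) = lin_ext (\<lambda>x. f (x + z)) t"
    and "lin_ext f (Poly_Mapping.single z 1 * t) = lin_ext (\<lambda>x. f (z + x)) t"
proof -
  have "(\<lambda>t. lin_ext f (t * Poly_Mapping.single z 1)) = lin_ext (\<lambda>x. f (x + z))"
    by (rule additive_eqI)
      (simp_all add: additive_def lin_ext_add distrib_right mult_single lin_ext_single)
  then show "lin_ext f (t * Poly_Mapping.single z 1) = lin_ext (\<lambda>x. f (x + z)) t" by (rule fun_cong)
  have "(\<lambda>t. lin_ext f (Poly_Mapping.single z 1 * t)) = lin_ext (\<lambda>x. f (z + x))"
    by (rule additive_eqI)
      (simp_all add: additive_def lin_ext_add distrib_left mult_single lin_ext_single)
  then show "lin_ext f (Poly_Mapping.single z 1 * t) = lin_ext (\<lambda>x. f (z + x)) t" by (rule fun_cong)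
qed

lemma lin_ext_mult_right: "lin_ext (\<lambda>x. f x * r) t = lin_ext f t * r"
  by (simp add: lin_ext_def sum_distrib_right mult.assoc)

lemma sweedler_mult_right: "sweedler (\<lambda>x y. B x y * r) u = sweedler B u * r"
  by (simp add: sweedler_def lin_ext_mult_right[symmetric] case_prod_unfold)

lemma sweedler_Nil: "sweedler B (monomial []) = 0"
  using is_coproduct_coproduct by (simp add: sweedler_def is_coproduct_def monomial_Nil lin_ext_def)

text \<open>Leibniz rule with the last letter split off: the summands come from \<Delta>(u) (1
  \<otimes> l) and (u \<otimes> 1) \<Delta>(l).\<close>

lemma sweedler_snoc:
  "sweedler B (monomial (u @ [l])) = sweedler (\<lambda>x y. B x (y * monomial [l])) (monomial u)
     + lin_ext (\<lambda>(x, y). B (monomial u * monomial x) (monomial y)) (coproduct (monomial [l]))"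
proof -
  have *: "coproduct (monomial (u @ [l])) =
      coproduct (monomial u) * Poly_Mapping.single ([], [l]) 1 +
      Poly_Mapping.single (u, []) 1 * coproduct (monomial [l])"
    using is_coproduct_coproduct
    by (simp add: is_coproduct_def flip: monomial_mult tensor_monomial monomial_Nil)
  show ?thesis
    by (simp add: sweedler_def * lin_ext_add lin_ext_mult_single case_prod_unfold monomial_mult
        plus_prod_def plus_list_def)
qed

lemma coproduct_letter:
  "coproduct \<c> = Poly_Mapping.single ([], []) 1 + Poly_Mapping.single ([], []) 1"
  "coproduct \<d> = Poly_Mapping.single ([], [C]) 1 + Poly_Mapping.single ([C], []) 1"
  using is_coproduct_coproduct
  by (simp_all add: is_coproduct_def mult_2 flip: monomial_Nil tensor_monomial)

lemma sweedler_snoc_C: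
  "sweedler B (monomial (u @ [C])) =
     sweedler (\<lambda>x y. B x (y * \<c>)) (monomial u) + 2 * B (monomial u) 1"
  by (simp add: sweedler_snoc coproduct_letter lin_ext_add lin_ext_single monomial_Nil mult_2)

lemma sweedler_snoc_D:
  "sweedler B (monomial (u @ [D])) =
     sweedler (\<lambda>x y. B x (y * \<d>)) (monomial u) + B (monomial u) \<c> + B (monomial (u @ [C])) 1"
  by (simp add: sweedler_snoc coproduct_letter lin_ext_add lin_ext_single monomial_Nil monomial_mult)

text \<open>The hypotheses on \<open>K\<close> are the recursion that the Leibniz rule yields for
  the Sweedler sum itself.\<close>

lemma sweedler_eqI:
  fixes g :: "cdpoly \<Rightarrow> cdpoly" and K :: "letter list \<Rightarrow> cdpoly"
  assumes "K [] = 0"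
    and "\<And>u. K (u @ [C]) = K u * \<c> + 2 * g (monomial u) * \<d>"
    and "\<And>u. K (u @ [D]) = K u * \<d> + g (monomial u) * \<d> * \<c> + g (monomial (u @ [C])) * \<d>"
  shows "sweedler (\<lambda>x y. g x * \<d> * y) (monomial u) = K u"
proof (induction u rule: rev_induct)
  case Nil
  then show ?case by (simp add: sweedler_Nil assms)
next
  case (snoc l u)
  have "sweedler (\<lambda>x y. g x * \<d> * (y * r)) (monomial u) = K u * r" for r
    using snoc.IH sweedler_mult_right[of "\<lambda>x y. g x * \<d> * y" r] by (simp add: mult.assoc)
  then show ?case
    by (cases l) (simp_all add: sweedler_snoc_C sweedler_snoc_D assms mult.assoc)
qed

text \<open>Since G(y c) = G(y) c + y d and G(y d) = G(y) d + y c d, the plain Sweedler sum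
  \<open>K\<close> enters the recursion for the sum with G.\<close>

lemma sweedler_G_eqI:
  fixes g :: "cdpoly \<Rightarrow> cdpoly" and K T :: "letter list \<Rightarrow> cdpoly"
  assumes K: "\<And>u. sweedler (\<lambda>x y. g x * \<d> * y) (monomial u) = K u"
    and "T [] = 0"
    and "\<And>u. T (u @ [C]) = T u * \<c> + K u * \<d>"
    and "\<And>u. T (u @ [D]) = T u * \<d> + K u * \<c> * \<d> + g (monomial u) * \<d> * \<d>"
  shows "sweedler (\<lambda>x y. g x * \<d> * G y) (monomial u) = T u"
proof (induction u rule: rev_induct)
  case Nil
  then show ?case by (simp add: sweedler_Nil assms)
next
  case (snoc l u)
  have G: "G (x * y) = G x * y + x * G y" "G \<c> = \<d>" "G \<d> = \<c> * \<d>" for x y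
    using is_G_G by (simp_all add: is_G_def)
  \<comment> \<open>Hence the coproduct summands of a letter with second factor 1 drop out.\<close>
  have G1: "G 1 = 0"
    using G(1)[of 1 1] by simp
  have "sweedler (\<lambda>x y. g x * \<d> * (y * r)) (monomial u) = K u * r" for r
    using K sweedler_mult_right[of "\<lambda>x y. g x * \<d> * y" r] by (simp add: mult.assoc)
  moreover have "sweedler (\<lambda>x y. g x * \<d> * (G y * r)) (monomial u) = T u * r" for r
    using snoc.IH sweedler_mult_right[of "\<lambda>x y. g x * \<d> * G y" r] by (simp add: mult.assoc)
  ultimately show ?case
    by (cases l) (simp_all add: sweedler_snoc_C sweedler_snoc_D assms G G1 distrib_left sweedler_fun_add mult.assoc)
qed

section \<open>Comparison with the diamond product\<close>

lemma path_sum_eq_diamond: "path_sum (rax u) (rax v) None = monomial u \<diamondop> monomial v"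
\<comment> \<open>\<open>u\<close> stays arbitrary because the Sweedler sums evaluate the smaller
  product at other words, such as \<open>u @ [C]\<close>.\<close>
proof (induction v arbitrary: u rule: rev_induct)
  case Nil
  \<comment> \<open>The version with \<open>Some R\<close> is carried along because removing a final
    \<open>R\<close> leaves a path followed by \<open>R\<close>.\<close>
  have "path_sum (rax u) [] None = monomial u \<and> path_sum (rax u) [] (Some R) = monomial u"
  proof (induction u rule: rev_induct)
    case Nil
    then show ?case by (simp add: path_sum.simps monomial_Nil)
  next
    case (snoc l u)
    have mid: "path_sum (D1 # rax u) [] (Some R) = 0"
      by (subst path_sum.simps) simp
    show ?case
      by (cases l; subst (1 2) path_sum.simps; simp add: snoc.IH mid path_sum_next_RR monomial_mult)
  qed
  then show ?case
    using is_diamond_diamond by (simp add: is_diamond_def monomial_Nil)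
next
  case (snoc l v)
  let ?g = "\<lambda>w. w \<diamondop> monomial v"
  note dia = is_diamond_diamond[unfolded is_diamond_def]
  note IH = snoc.IH snoc.IH[of "_ @ [C]", simplified]
  show ?case
  proof (cases l)
    case C
    have "sweedler (\<lambda>x y. ?g x * \<d> * y) (monomial u) = path_sum (rax u) (C1 # rax v) (Some R)"
      by (rule sweedler_eqI) (simp_all add: path_sum_row_C_rec IH)
    then show ?thesis
      using dia by (simp add: C path_sum_row_C snoc.IH flip: monomial_mult)
  next
    case D
    have K: "sweedler (\<lambda>x y. ?g x * \<d> * y) (monomial u) = path_sum (rax u) (D1 # rax v) (Some R)" for u
      by (rule sweedler_eqI) (simp_all add: path_sum_row_D1_rec IH)
    have "sweedler (\<lambda>x y. ?g x * \<d> * G y) (monomial u) = path_sum (rax u) (D2 # D1 # rax v) (Some R)"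
      by (rule sweedler_G_eqI[OF K]) (simp_all add: path_sum_row_D2_rec snoc.IH)
    moreover have "sweedler (\<lambda>x y. ?g x * \<d> * (y * \<c>)) (monomial u) =
        path_sum (rax u) (D1 # rax v) (Some R) * \<c>"
      using K sweedler_mult_right[of "\<lambda>x y. ?g x * \<d> * y" \<c>] by (simp add: mult.assoc)
    ultimately show ?thesis
      using dia
      by (simp add: D path_sum_row_D2 snoc.IH Pyr_def distrib_left sweedler_fun_add add.assoc flip: monomial_mult)
  qed
qed

section \<open>Path sums as sums over lists of steps\<close>

text \<open>Violating a local condition makes the step weigh zero, so that sums may run over all
  paths with a given end point.\<close>

definition step_val :: "label_part \<Rightarrow> label_part \<Rightarrow> step \<Rightarrow> step option \<Rightarrow> cdpoly" where
  "step_val a b s N = (case s of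
      R \<Rightarrow> if a = D1 \<and> N = Some R then 0 else \<c>
    | U \<Rightarrow> if b = D1 \<or> N \<in> {Some R, Some RR} then 0 else \<c>
    | Diag \<Rightarrow> diag_wt a b N
    | RR \<Rightarrow> if a = D1 then \<d> else 0
    | UU \<Rightarrow> if b = D1 \<and> N \<notin> {Some R, Some RR} then \<d> else 0)"

definition next_step :: "step list \<Rightarrow> nat \<Rightarrow> step option \<Rightarrow> step option" where
  "next_step P i N = (if Suc i < length P then Some (P ! Suc i) else N)"

text \<open>A vertical step may start at the right end of the horizontal axis, where
  \<open>xs ! xpos P i\<close> is unspecified; \<open>step_val\<close> ignores that part for
  vertical steps, and symmetrically for horizontal ones.\<close>

definition path_val ::
    "label_part list \<Rightarrow> label_part list \<Rightarrow> step list \<Rightarrow> step option \<Rightarrow> cdpoly" where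
  "path_val xs ys P N = prod_list (map (\<lambda>i.
     step_val (xs ! xpos P i) (ys ! ypos P i) (P ! i) (next_step P i N)) [0..<length P])"

definition paths_to :: "nat \<Rightarrow> nat \<Rightarrow> step list set" where
  "paths_to x y = {P. sum_list (map dx P) = x \<and> sum_list (map dy P) = y}"

lemma path_val_snoc:
  "path_val xs ys (P @ [s]) N = path_val xs ys P (Some s) *
     step_val (xs ! sum_list (map dx P)) (ys ! sum_list (map dy P)) s N"
proof -
  define F where "F = (\<lambda>i. step_val (xs ! xpos (P @ [s]) i) (ys ! ypos (P @ [s]) i) ((P @ [s]) ! i)
    (next_step (P @ [s]) i N))"
  have "path_val xs ys (P @ [s]) N = prod_list (map F ([0..<length P] @ [length P]))"
    by (simp add: path_val_def F_def)
  also have "\<dots> = prod_list (map F [0..<length P]) * F (length P)"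
    by simp
  also have "map F [0..<length P] = map (\<lambda>i. step_val (xs ! xpos P i) (ys ! ypos P i) (P ! i)
      (next_step P i (Some s))) [0..<length P]"
    by (rule map_cong)
      (auto simp: F_def xpos_def ypos_def next_step_def nth_append nth_append_length_plus less_Suc_eq)
  finally show ?thesis
    by (simp add: path_val_def F_def) (simp add: xpos_def ypos_def next_step_def)
qed

lemma finite_paths_to: "finite (paths_to x y)"
proof (rule finite_subset)
  have len: "length P \<le> sum_list (map dx P) + sum_list (map dy P)" for P
  proof (induction P)
    case (Cons s P)
    then show ?case by (cases s) auto
  qed simp
  have "s \<in> {R, U, Diag, RR, UU}" for s
    by (cases s) auto
  then show "paths_to x y \<subseteq> {P. set P \<subseteq> {R, U, Diag, RR, UU} \<and> length P \<le> x + y}"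
    using len by (auto simp: paths_to_def)
  show "finite {P. set P \<subseteq> {R, U, Diag, RR, UU} \<and> length P \<le> x + y}"
    by (rule finite_lists_length_le) simp
qed

lemma paths_to_snoc:
  "paths_to x y = (if x = 0 \<and> y = 0 then {[]} else {}) \<union>
     (\<Union>s\<in>{s \<in> {R, U, Diag, RR, UU}. dx s \<le> x \<and> dy s \<le> y}.
        (\<lambda>P. P @ [s]) ` paths_to (x - dx s) (y - dy s))" (is "_ = ?rhs")
proof (intro set_eqI iffI)
  fix P assume P: "P \<in> paths_to x y"
  show "P \<in> ?rhs"
  proof (cases P rule: rev_cases)
    case Nil
    then show ?thesis using P by (simp add: paths_to_def)
  next
    case (snoc Q s)
    have "s \<in> {R, U, Diag, RR, UU}"
      by (cases s) simp_all
    moreover have "dx s \<le> x" "dy s \<le> y" "Q \<in> paths_to (x - dx s) (y - dy s)"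
      using P by (auto simp: snoc paths_to_def)
    ultimately show ?thesis
      unfolding snoc by blast
  qed
next
  fix P assume "P \<in> ?rhs"
  then consider "x = 0" "y = 0" "P = []"
    | s Q where "dx s \<le> x" "dy s \<le> y" "Q \<in> paths_to (x - dx s) (y - dy s)" "P = Q @ [s]"
    by (simp only: Un_iff UN_iff mem_Collect_eq image_iff split: if_splits) blast+
  then show "P \<in> paths_to x y"
    by cases (simp_all add: paths_to_def)
qed

lemma sum_path_val_snoc:
  "(\<Sum>P\<in>paths_to x y. path_val xs ys P N) = (if x = 0 \<and> y = 0 then 1 else 0) +
     (\<Sum>s\<in>{R, U, Diag, RR, UU}. if dx s \<le> x \<and> dy s \<le> y then
        (\<Sum>P\<in>paths_to (x - dx s) (y - dy s). path_val xs ys P (Some s)) *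
        step_val (xs ! (x - dx s)) (ys ! (y - dy s)) s N else 0)"
proof -
  define S where "S = {R, U, Diag, RR, UU}"
  have fin: "finite S" by (simp add: S_def)
  let ?A = "{s \<in> S. dx s \<le> x \<and> dy s \<le> y}"
  let ?I = "\<lambda>s. (\<lambda>P. P @ [s]) ` paths_to (x - dx s) (y - dy s)"
  let ?F = "\<lambda>s. (\<Sum>P\<in>paths_to (x - dx s) (y - dy s). path_val xs ys P (Some s)) *
        step_val (xs ! (x - dx s)) (ys ! (y - dy s)) s N"
  have "(\<Sum>P\<in>paths_to x y. path_val xs ys P N) =
      (\<Sum>P\<in>(if x = 0 \<and> y = 0 then {[]} else {}). path_val xs ys P N) +
      (\<Sum>P\<in>(\<Union>s\<in>?A. ?I s). path_val xs ys P N)"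
    by (subst paths_to_snoc, fold S_def, rule sum.union_disjoint) (auto simp: finite_paths_to fin)
  also have "(\<Sum>P\<in>(if x = 0 \<and> y = 0 then {[]} else {}). path_val xs ys P N) =
      (if x = 0 \<and> y = 0 then 1 else 0)"
    by (simp add: path_val_def)
  also have "(\<Sum>P\<in>(\<Union>s\<in>?A. ?I s). path_val xs ys P N) = (\<Sum>s\<in>?A. \<Sum>P\<in>?I s. path_val xs ys P N)"
    by (rule sum.UNION_disjoint) (auto simp: finite_paths_to fin)
  also have "\<dots> = (\<Sum>s\<in>?A. ?F s)"
  proof (rule sum.cong[OF refl])
    fix s
    have "(\<Sum>P\<in>?I s. path_val xs ys P N) =
        (\<Sum>P\<in>paths_to (x - dx s) (y - dy s). path_val xs ys (P @ [s]) N)"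
      by (subst sum.reindex) (simp_all add: inj_on_def)
    also have "\<dots> = ?F s"
      unfolding sum_distrib_right path_val_snoc by (rule sum.cong) (simp_all add: paths_to_def)
    finally show "(\<Sum>P\<in>?I s. path_val xs ys P N) = ?F s" .
  qed
  also have "\<dots> = (\<Sum>s\<in>S. if dx s \<le> x \<and> dy s \<le> y then ?F s else 0)"
    by (rule sum.inter_filter[OF fin])
  finally show ?thesis
    unfolding S_def .
qed

lemma nat_cases_2:
  obtains "n = 0" | "n = Suc 0" | n' where "n = Suc (Suc n')"
  by (metis not0_implies_Suc)

lemma sum_path_val:
  assumes "x \<le> length xs" "y \<le> length ys"
  shows "(\<Sum>P\<in>paths_to x y. path_val xs ys P N) = path_sum (rev (take x xs)) (rev (take y ys)) N"
  using assms
proof (induction "x + y" arbitrary: x y N rule: less_induct)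
  case less
  have IH: "(\<Sum>P\<in>paths_to x' y'. path_val xs ys P M) = path_sum (rev (take x' xs)) (rev (take y' ys)) M"
    if "x' + y' < x + y" "x' \<le> x" "y' \<le> y" for x' y' M
    using less that by simp
  have tx: "rev (take (Suc i) xs) = xs ! i # rev (take i xs)" if "Suc i \<le> x" for i
    using that less.prems by (simp add: take_Suc_conv_app_nth)
  have ty: "rev (take (Suc i) ys) = ys ! i # rev (take i ys)" if "Suc i \<le> y" for i
    using that less.prems by (simp add: take_Suc_conv_app_nth)
  \<comment> \<open>\<open>T s\<close> collects the paths with last step \<open>s\<close>; the
    values are matched with the clauses of \<open>path_sum\<close>, \<open>U\<close> and
    \<open>UU\<close> being grouped as there.\<close>
  define T where "T s = (if dx s \<le> x \<and> dy s \<le> y then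
        (\<Sum>P\<in>paths_to (x - dx s) (y - dy s). path_val xs ys P (Some s)) *
        step_val (xs ! (x - dx s)) (ys ! (y - dy s)) s N else 0)" for s
  have "(\<Sum>P\<in>paths_to x y. path_val xs ys P N) =
      (if x = 0 \<and> y = 0 then 1 else 0) + (\<Sum>s\<in>{R, U, Diag, RR, UU}. T s)"
    unfolding T_def by (rule sum_path_val_snoc)
  moreover have "(\<Sum>s\<in>{R, U, Diag, RR, UU}. T s) = T R + T RR + (T U + T UU) + T Diag"
    by (simp add: add_ac)
  moreover have "T R = (case rev (take x xs) of [] \<Rightarrow> 0 | a # xs' \<Rightarrow>
        if a = D1 \<and> N = Some R then 0 else path_sum xs' (rev (take y ys)) (Some R) * \<c>)"
    by (cases x) (simp_all add: T_def IH tx step_val_def)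
  moreover have "T RR = (case rev (take x xs) of a # b # xs' \<Rightarrow>
        if b = D1 then path_sum xs' (rev (take y ys)) (Some RR) * \<d> else 0 | _ \<Rightarrow> 0)"
    by (cases x rule: nat_cases_2) (simp_all add: T_def IH tx step_val_def)
  moreover have "T U + T UU = (if N \<in> {Some R, Some RR} then 0 else
        (case rev (take y ys) of [] \<Rightarrow> 0 | b # ys' \<Rightarrow>
          if b = D1 then 0 else path_sum (rev (take x xs)) ys' (Some U) * \<c>)
      + (case rev (take y ys) of a # b # ys' \<Rightarrow>
          if b = D1 then path_sum (rev (take x xs)) ys' (Some UU) * \<d> else 0 | _ \<Rightarrow> 0))"
    by (cases y rule: nat_cases_2) (simp_all add: T_def IH ty step_val_def)
  moreover have "T Diag = (case (rev (take x xs), rev (take y ys)) of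
        (a # xs', b # ys') \<Rightarrow> path_sum xs' ys' (Some Diag) * diag_wt a b N | _ \<Rightarrow> 0)"
    by (cases x; cases y) (simp_all add: T_def IH tx ty step_val_def split: list.split)
  moreover have "x = 0 \<and> y = 0 \<longleftrightarrow> rev (take x xs) = [] \<and> rev (take y ys) = []"
    using less.prems by auto
  ultimately show ?case
    by (subst path_sum.simps) (simp only: add.assoc)
qed

section \<open>Admissibility as a local condition\<close>

lemma length_axis: "length (axis w) = deg w"
  by (induction w) (auto simp: axis_def deg_def split: letter.split)

lemma axis_Nil [simp]: "axis [] = []"
  and axis_Cons [simp]: "axis (C # w) = C1 # axis w" "axis (D # w) = D1 # D2 # axis w"
  by (simp_all add: axis_def)

lemma axis_D1_D2:
  assumes "Suc i < length (axis w)"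
  shows "axis w ! i = D1 \<longleftrightarrow> axis w ! Suc i = D2"
  using assms
proof (induction w arbitrary: i)
  case (Cons l w)
  have hd: "axis w ! 0 \<noteq> D2" if "axis w \<noteq> []"
    using that by (cases w rule: list.exhaust; cases "hd w") auto
  show ?case
  proof (cases l)
    case C
    then show ?thesis using Cons hd by (cases i) auto
  next
    case D
    then show ?thesis using Cons hd by (cases i rule: nat_cases_2) auto
  qed
qed simp

lemma pos_Suc:
  assumes "i < length P"
  shows "xpos P (Suc i) = xpos P i + dx (P ! i)" "ypos P (Suc i) = ypos P i + dy (P ! i)"
  using assms by (simp_all add: xpos_def ypos_def take_Suc_conv_app_nth)

lemma pos_mono:
  assumes "i \<le> j"
  shows "xpos P i \<le> xpos P j" "ypos P i \<le> ypos P j"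
proof -
  obtain k where "j = i + k" using assms le_Suc_ex by blast
  then show "xpos P i \<le> xpos P j" "ypos P i \<le> ypos P j"
    by (simp_all add: xpos_def ypos_def take_add)
qed

lemma pos_step_le:
  assumes "P \<in> paths_to x y" "i < length P"
  shows "xpos P i + dx (P ! i) \<le> x" "ypos P i + dy (P ! i) \<le> y"
  using pos_mono[of "Suc i" "length P" P] pos_Suc[OF assms(2)] assms
  by (simp_all add: paths_to_def xpos_def ypos_def)

text \<open>The step that first rises to this height must be diagonal: \<open>U\<close> is banned
  beside a bottom half, and \<open>UU\<close> spans a whole label, so it cannot end in the middle of
  one.\<close>

lemma reach_mid_by_Diag:
  assumes P: "P \<in> paths_to x (deg v)" and j: "j < length P"
    and top: "ypos P j < deg v" "axis v ! ypos P j = D2"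
    and steps: "\<And>i. i < length P \<Longrightarrow> P ! i = U \<Longrightarrow> right_part v P i \<noteq> D1"
      "\<And>i. i < length P \<Longrightarrow> P ! i = UU \<Longrightarrow> right_part v P i = D1"
  obtains i where "i < length P" "P ! i = Diag" "right_part v P i = D1" "ypos P j = ypos P i + 1"
proof -
  have "axis v ! 0 \<noteq> D2" if "axis v \<noteq> []"
    using that by (cases v rule: list.exhaust; cases "hd v") auto
  then have pos: "ypos P j > 0"
    using top by (cases "ypos P j") (auto simp flip: length_axis)
  define i where "i = (LEAST i. ypos P (Suc i) \<ge> ypos P j)"
  have ex: "\<exists>i<j. ypos P (Suc i) \<ge> ypos P j"
    using pos by (cases j) (auto simp: ypos_def)
  have i: "ypos P (Suc i) \<ge> ypos P j"
    unfolding i_def using ex by (metis (mono_tags, lifting) LeastI)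
  have ij: "i < j"
    unfolding i_def using ex by (metis (mono_tags, lifting) Least_le le_less_trans)
  have less: "ypos P i < ypos P j"
  proof (cases i)
    case 0
    then show ?thesis using pos by (simp add: ypos_def)
  next
    case (Suc k)
    then show ?thesis using not_less_Least[of k "\<lambda>i. ypos P (Suc i) \<ge> ypos P j"] by (simp add: i_def)
  qed
  have eq: "ypos P j = ypos P i + dy (P ! i)"
    using i pos_mono(2)[of "Suc i" j P] ij j pos_Suc(2)[of i P] by simp
  have il: "i < length P" using ij j by simp
  have D1: "axis v ! k = D1" if "Suc k = ypos P j" for k
    using that top axis_D1_D2[of k v] by (simp add: length_axis)
  have "P ! i = Diag"
  proof (cases "P ! i")
    case U
    then show ?thesis using steps(1)[OF il] D1[of "ypos P i"] eq by (simp add: right_part_def)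
  next
    case UU
    have "axis v ! Suc (ypos P i) = D2"
      using steps(2)[OF il UU] axis_D1_D2[of "ypos P i" v] eq UU top
      by (simp add: right_part_def length_axis)
    then show ?thesis using D1[of "Suc (ypos P i)"] eq UU by simp
  qed (use eq less in auto)
  then show ?thesis
    using that[OF il] D1[of "ypos P i"] eq by (simp add: right_part_def)
qed

definition local_ok :: "label_part \<Rightarrow> label_part \<Rightarrow> step \<Rightarrow> step option \<Rightarrow> bool" where
  "local_ok a b s N \<longleftrightarrow>
     \<not> (s \<in> {U, UU} \<and> N \<in> {Some R, Some RR}) \<and>
     (s = U \<longrightarrow> b \<noteq> D1) \<and>
     \<not> (s = R \<and> N = Some R \<and> a = D1) \<and>
     (s = UU \<longrightarrow> b = D1) \<and> (s = RR \<longrightarrow> a = D1) \<and>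
     \<not> (s = Diag \<and> a = D1 \<and> b = D2 \<and> N = Some R)"

lemma step_val_eq_0: "\<not> local_ok a b s N \<Longrightarrow> step_val a b s N = 0"
  by (cases s) (auto simp: local_ok_def step_val_def diag_wt_def)

lemma next_step_eq_Some: "next_step P i None = Some s \<longleftrightarrow> Suc i < length P \<and> P ! Suc i = s"
  by (simp add: next_step_def)

lemma followed_by_iff: "followed_by P i S \<longleftrightarrow> next_step P i None \<in> Some ` S"
  by (auto simp: followed_by_def next_step_def)

lemma step_wt_eq_step_val:
  "local_ok (above_part u P i) (right_part v P i) (P ! i) (next_step P i None) \<Longrightarrow>
     step_wt u v P i = step_val (above_part u P i) (right_part v P i) (P ! i) (next_step P i None)"
  by (cases "P ! i")
    (auto simp: local_ok_def step_wt_def step_val_def diag_wt_def diag_coeff_def followed_by_iff)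

text \<open>Only condition 4 needs an argument: \<open>reach_mid_by_Diag\<close> supplies its first
  diagonal step whenever a diagonal step is beside a top half; conversely, the unit interval just
  above a bottom half is a top half.\<close>

lemma Gamma_iff_local_ok:
  "P \<in> Gamma u v \<longleftrightarrow> P \<in> paths_to (deg u) (deg v) \<and>
     (\<forall>i<length P. local_ok (above_part u P i) (right_part v P i) (P ! i) (next_step P i None))"
    (is "_ \<longleftrightarrow> ?paths \<and> ?ok")
proof
  assume P: "P \<in> Gamma u v"
  then have ?paths
    by (simp add: Gamma_def paths_def paths_to_def xpos_def ypos_def)
  have turn: "\<And>i. Suc i < length P \<Longrightarrow> P ! i \<in> {U, UU} \<Longrightarrow> P ! Suc i \<notin> {R, RR}"
    using P unfolding Gamma_def paths_def by blast
  have U: "\<And>i. i < length P \<Longrightarrow> P ! i = U \<Longrightarrow> right_part v P i \<noteq> D1"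
    and R: "\<And>i. Suc i < length P \<Longrightarrow> P ! i = R \<Longrightarrow> P ! Suc i = R \<Longrightarrow> above_part u P i \<noteq> D1"
    and UU: "\<And>i. i < length P \<Longrightarrow> P ! i = UU \<Longrightarrow> right_part v P i = D1"
    and RR: "\<And>i. i < length P \<Longrightarrow> P ! i = RR \<Longrightarrow> above_part u P i = D1"
    using P by (simp_all add: Gamma_def)
  have Diag: False if "Suc j < length P" "P ! j = Diag" "above_part u P j = D1"
    "right_part v P j = D2" "P ! Suc j = R" for j
  proof -
    have j: "j < length P"
      using that by simp
    have less: "ypos P j < deg v"
      using pos_step_le(2)[OF \<open>?paths\<close> j] that by simp
    have top: "axis v ! ypos P j = D2"
      using that by (simp add: right_part_def)
    obtain i where "i < length P" "P ! i = Diag" "right_part v P i = D1" "ypos P j = ypos P i + 1"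
      by (rule reach_mid_by_Diag[OF \<open>?paths\<close> j less top U UU])
    then show False
      using P that unfolding Gamma_def by blast
  qed
  have ?ok
    unfolding local_ok_def next_step_eq_Some insert_iff empty_iff
    using turn U R UU RR Diag by simp blast
  then show "?paths \<and> ?ok"
    using \<open>?paths\<close> by blast
next
  assume ok: "?paths \<and> ?ok"
  have turn: "\<And>i. Suc i < length P \<Longrightarrow> P ! i \<in> {U, UU} \<Longrightarrow> P ! Suc i \<notin> {R, RR}"
    and U: "\<And>i. i < length P \<Longrightarrow> P ! i = U \<Longrightarrow> right_part v P i \<noteq> D1"
    and R: "\<And>i. Suc i < length P \<Longrightarrow> P ! i = R \<Longrightarrow> P ! Suc i = R \<Longrightarrow> above_part u P i \<noteq> D1"
    and UU: "\<And>i. i < length P \<Longrightarrow> P ! i = UU \<Longrightarrow> right_part v P i = D1"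
    and RR: "\<And>i. i < length P \<Longrightarrow> P ! i = RR \<Longrightarrow> above_part u P i = D1"
    and Diag: "\<And>i. Suc i < length P \<Longrightarrow> P ! i = Diag \<Longrightarrow> above_part u P i = D1 \<Longrightarrow>
      right_part v P i = D2 \<Longrightarrow> P ! Suc i \<noteq> R"
    using ok by (auto simp: local_ok_def next_step_def dest: Suc_lessD)
  have False if "P ! i = Diag" "right_part v P i = D1"
      "Suc j < length P" "P ! j = Diag" "P ! Suc j = R" "above_part u P j = D1" "ypos P j = ypos P i + 1"
    for i j
  proof -
    have "Suc (ypos P i) < deg v"
      using pos_step_le(2)[of P "deg u" "deg v" j] ok that by simp
    then have "right_part v P j = D2"
      using axis_D1_D2[of "ypos P i" v] that by (simp add: right_part_def length_axis)
    then show False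
      using Diag[of j] that by simp
  qed
  moreover have "P \<in> paths (deg u) (deg v)"
    using ok turn unfolding paths_def paths_to_def xpos_def ypos_def by auto
  ultimately show "P \<in> Gamma u v"
    using U R UU RR unfolding Gamma_def mem_Collect_eq by blast
qed

lemma prod_list_eq_0: "0 \<in> set xs \<Longrightarrow> prod_list xs = (0 :: 'a :: semiring_1)"
  by (induction xs) auto

text \<open>A path outside \<open>Gamma u v\<close> has a step violating \<open>local_ok\<close>,
  whose factor in \<open>path_val\<close> is zero.\<close>

lemma sum_wt_eq_sum_path_val:
  "(\<Sum>P\<in>Gamma u v. wt u v P) = (\<Sum>P\<in>paths_to (deg u) (deg v). path_val (axis u) (axis v) P None)"
proof (rule sum.mono_neutral_cong_left)
  show "\<forall>P\<in>paths_to (deg u) (deg v) - Gamma u v. path_val (axis u) (axis v) P None = 0"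
  proof
    fix P assume "P \<in> paths_to (deg u) (deg v) - Gamma u v"
    then obtain i where "i < length P"
      "\<not> local_ok (above_part u P i) (right_part v P i) (P ! i) (next_step P i None)"
      by (auto simp: Gamma_iff_local_ok)
    then show "path_val (axis u) (axis v) P None = 0"
      unfolding path_val_def
      by (intro prod_list_eq_0)
        (auto simp: step_val_eq_0 above_part_def right_part_def intro!: image_eqI[of _ _ i])
  qed
  show "wt u v P = path_val (axis u) (axis v) P None" if "P \<in> Gamma u v" for P
    using that unfolding wt_def path_val_def Gamma_iff_local_ok
    by (intro arg_cong[of _ _ prod_list] map_cong)
      (auto simp: step_wt_eq_step_val simp flip: above_part_def right_part_def)
qed (auto simp: finite_paths_to Gamma_iff_local_ok)

theorem theorem5p4:
  fixes u v :: "letter list"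
  shows "monomial u \<diamondop> monomial v = (\<Sum>P\<in>Gamma u v. wt u v P)"
  \<comment> \<open>At the full degrees the prefixes in \<open>sum_path_val\<close> are the whole
    axes.\<close>
  using sum_path_val[of "deg u" "axis u" "deg v" "axis v" None]
  by (simp add: sum_wt_eq_sum_path_val path_sum_eq_diamond length_axis flip: rax_def)

end
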